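(* Let $n$ range over a sequence of natural numbers going to infinity. For each $n$ in this sequence, let $f=f^{(n)}$ be a monic polynomial of degree $n$ with all zeroes in the closed unit disk $\{z\in\mathbb{C}:|z|\le1\}$, and let $a=a^{(n)}\in[0,1]$ be such that $f(a)=0$. Suppose that $a^{(n)}=o\left(\frac{1}{\log n}\right)$, that is, $a^{(n)}\log n\to0$ as $n\to\infty$ along the sequence. Then it is impossible that, for every $n$ in the sequence, $f'$ has no zeroes in the closed disk $\{z\in\mathbb{C}:|z-a|\le1\}$. *)

theory Defs
  imports "HOL-Analysis.Analysis" "HOL-Computational_Algebra.Polynomial"
begin

end

theory Submission
  imports Defs "HOL-Complex_Analysis.Complex_Analysis" "HOL-Computational_Algebra.Fundamental_Theorem_Algebra"
begin

text \<open>Write \<open>f' = n P\<close> with \<open>P = \<Prod> (z - \<zeta>\<^sub>j)\<close>, suppose that every \<open>|\<zeta>\<^sub>j - a| > 1\<close>, and put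
  \<open>w\<^sub>j = 1 / (a - \<zeta>\<^sub>j)\<close>, \<open>S = \<Sum> w\<^sub>j = P'(a) / P(a)\<close>. Since the zeros of \<open>f\<close> lie in the unit disc,
  \<open>|n f - z f'| \<le> |z f'|\<close> for \<open>|z| \<ge> 1\<close>, and the maximum principle gives
  \<open>|f(z)| \<le> 2 \<Prod> |1 - cnj \<zeta>\<^sub>j z|\<close> in the disc. Near \<open>a\<close> the right-hand side exceeds \<open>2 |P(z)|\<close> by a factor
  of at most \<open>exp (4 a Re S)\<close>, because the \<open>\<zeta>\<^sub>j\<close> lie in a thin lune along the left half of the unit circle.
  If \<open>|S|\<^sup>2 = O(n)\<close>, then \<open>a (n - 1) \<le> 2 Re S\<close> makes this factor bounded, and Cauchy's inequality for \<open>f / P\<close>,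
  whose derivative at \<open>a\<close> is \<open>n\<close>, bounds \<open>n\<close>. Otherwise \<open>\<Sum> w\<^sub>j\<^sup>2 = - n + O(|S|)\<close> shows that
  \<open>P\<close> decays from \<open>a\<close> along a ray at angle \<open>2 \<pi> / 3\<close> or \<open>- 2 \<pi> / 3\<close>, where both the linear and the quadratic
  term of \<open>ln |P|\<close> decrease, while \<open>f\<close> stays comparable to \<open>n |P(a)| / |S|\<close>; at a fixed small distance
  from \<open>a\<close> this violates the upper bound.\<close>

section \<open>Logarithmic derivative of a polynomial with zeros in the unit disc\<close>

lemma monic_poly_splits:
  fixes p :: "complex poly"
  assumes "lead_coeff p = 1"
  obtains r where "\<And>z. poly p z = (\<Prod>j<degree p. z - r j)"
    and "\<And>j. j < degree p \<Longrightarrow> poly p (r j) = 0"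
proof -
  obtain r where "smult (lead_coeff p) (\<Prod>j<degree p. [:-r j, 1:]) = p"
    by (rule complex_poly_decompose')
  hence p: "p = (\<Prod>j<degree p. [:-r j, 1:])"
    using assms by simp
  have eq: "poly p z = (\<Prod>j<degree p. z - r j)" for z
    by (subst p) (simp add: poly_prod)
  moreover have "poly p (r j) = 0" if "j < degree p" for j
    unfolding eq using that by (intro prod_zero) auto
  ultimately show thesis by (rule that)
qed

text \<open>The map \<open>u \<mapsto> 1 / (1 - u)\<close> sends the unit disc into the half-plane
  \<open>Re \<ge> 1 / 2\<close>; here \<open>u = r / z\<close>.\<close>

lemma Re_divide_diff_ge_half:
  fixes z r :: complex
  assumes "cmod r \<le> 1" "cmod z > 1"
  shows "Re (z / (z - r)) \<ge> 1 / 2"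
proof -
  from assms have ne: "z \<noteq> r" by auto
  have "cmod r ^ 2 \<le> cmod z ^ 2"
    using assms by (intro power_mono) auto
  hence *: "(Re r)\<^sup>2 + (Im r)\<^sup>2 \<le> (Re z)\<^sup>2 + (Im z)\<^sup>2" by (simp add: cmod_power2)
  have pos: "(Re z - Re r)\<^sup>2 + (Im z - Im r)\<^sup>2 > 0"
    using ne by (auto simp: complex_eq_iff sum_power2_gt_zero_iff)
  have "Re (z / (z - r)) = (Re z * (Re z - Re r) + Im z * (Im z - Im r)) / ((Re z - Re r)\<^sup>2 + (Im z - Im r)\<^sup>2)"
    by (simp add: Re_divide)
  also have "\<dots> \<ge> 1 / 2"
    using pos * by (simp add: pos_le_divide_eq) (simp add: power2_eq_square algebra_simps)
  finally show ?thesis .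
qed

lemma deriv_prod_linear:
  fixes r :: "nat \<Rightarrow> complex"
  assumes "\<And>j. j < n \<Longrightarrow> z \<noteq> r j"
  shows "((\<lambda>z. \<Prod>j<n. z - r j) has_field_derivative (\<Prod>j<n. z - r j) * (\<Sum>j<n. 1 / (z - r j))) (at z)"
  using assms by (intro has_field_derivative_prod') (auto intro!: derivative_eq_intros)

text \<open>Partial fractions write \<open>z p' / p\<close> as the sum of
  \<open>z / (z - r j)\<close> over the zeros, and each term lies in the half-plane
  \<open>Re \<ge> 1 / 2\<close>.\<close>

lemma Re_log_deriv_ge:
  fixes p :: "complex poly"
  assumes monic: "lead_coeff p = 1" and roots: "\<And>z. poly p z = 0 \<Longrightarrow> cmod z \<le> 1"
    and z: "cmod z > 1"
  shows "Re (z * poly (pderiv p) z / poly p z) \<ge> degree p / 2"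
proof -
  obtain r where r: "\<And>z. poly p z = (\<Prod>j<degree p. z - r j)"
    "\<And>j. j < degree p \<Longrightarrow> poly p (r j) = 0"
    using monic_poly_splits[OF monic] by blast
  have r1: "cmod (r j) \<le> 1" if "j < degree p" for j
    using r(2) roots that by blast
  have nz: "poly p z \<noteq> 0" using roots z by force
  have "((\<lambda>z. poly p z) has_field_derivative poly p z * (\<Sum>j<degree p. 1 / (z - r j))) (at z)"
    unfolding r(1) using r1 z by (intro deriv_prod_linear) force
  hence "poly (pderiv p) z = poly p z * (\<Sum>j<degree p. 1 / (z - r j))"
    using poly_DERIV DERIV_unique by blast
  hence "z * poly (pderiv p) z / poly p z = (\<Sum>j<degree p. z / (z - r j))"
    using nz by (simp add: sum_distrib_left sum_divide_distrib)
  moreover have "(\<Sum>j<degree p. Re (z / (z - r j))) \<ge> (\<Sum>j<degree p. 1 / 2)"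
    using r1 z by (intro sum_mono Re_divide_diff_ge_half) auto
  ultimately show ?thesis by simp
qed

text \<open>With \<open>q = z p' / p\<close>, the bound \<open>Re q \<ge> degree p / 2\<close> says
  exactly that \<open>q\<close> is no farther from \<open>degree p\<close> than from
  \<open>0\<close>.\<close>

lemma norm_polar_deriv_le:
  fixes p :: "complex poly"
  assumes monic: "lead_coeff p = 1" and roots: "\<And>z. poly p z = 0 \<Longrightarrow> cmod z \<le> 1"
    and z: "cmod z > 1"
  shows "cmod (degree p * poly p z - z * poly (pderiv p) z) \<le> cmod (z * poly (pderiv p) z)"
proof -
  define q where "q = z * poly (pderiv p) z / poly p z"
  have nz: "poly p z \<noteq> 0" using roots z by force
  have "Re q \<ge> degree p / 2"
    unfolding q_def by (rule Re_log_deriv_ge[OF assms])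
  hence "real (degree p) * degree p \<le> degree p * (2 * Re q)"
    by (intro mult_left_mono) auto
  hence "cmod (degree p - q) ^ 2 \<le> cmod q ^ 2"
    by (simp only: cmod_power2) (simp add: power2_eq_square algebra_simps)
  hence "cmod (degree p - q) \<le> cmod q"
    by (rule power2_le_imp_le) simp
  hence "cmod (poly p z) * cmod (degree p - q) \<le> cmod (poly p z) * cmod q"
    by (intro mult_left_mono) auto
  thus ?thesis
    using nz by (simp add: q_def flip: norm_mult) (simp add: algebra_simps)
qed

text \<open>Gauss-Lucas for the unit disc: outside it the logarithmic derivative has positive real
  part, so \<open>p'\<close> cannot vanish.\<close>

lemma critical_points_in_disc:
  fixes p :: "complex poly"
  assumes monic: "lead_coeff p = 1" and roots: "\<And>z. poly p z = 0 \<Longrightarrow> cmod z \<le> 1"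
    and deg: "degree p > 0" and z: "poly (pderiv p) z = 0"
  shows "cmod z \<le> 1"
proof (rule ccontr)
  assume "\<not> cmod z \<le> 1"
  hence "Re (z * poly (pderiv p) z / poly p z) \<ge> degree p / 2"
    using Re_log_deriv_ge[OF monic roots] by simp
  thus False using z deg by simp
qed

section \<open>Reflected critical product and the resulting bound on the polynomial\<close>

lemma norm_diff_le_norm_one_minus_cnj:
  assumes "cmod z \<le> 1" "cmod r \<le> 1"
  shows "cmod (z - r) \<le> cmod (1 - cnj r * z)"
proof -
  have "cmod (1 - cnj r * z) ^ 2 - cmod (z - r) ^ 2 = (1 - cmod z ^ 2) * (1 - cmod r ^ 2)"
    by (simp only: cmod_power2) (simp add: power2_eq_square algebra_simps)
  moreover have "(1 - cmod z ^ 2) * (1 - cmod r ^ 2) \<ge> 0"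
    using assms by (intro mult_nonneg_nonneg) (auto simp: power_le_one)
  ultimately have "cmod (z - r) ^ 2 \<le> cmod (1 - cnj r * z) ^ 2" by linarith
  thus ?thesis by (rule power2_le_imp_le) simp
qed

text \<open>On the circle \<open>cnj z = R^2 / z\<close>, so the reflected factor is
  \<open>cnj (z - r)\<close> times the unimodular \<open>z / R\<close>. Reflection moves the zero
  out of the disc without changing the modulus on the boundary.\<close>

lemma norm_reflected_linear_factor:
  assumes "cmod z = R" "R > 0"
  shows "cmod (of_real R - cnj r * z / of_real R) = cmod (z - r)"
proof -
  have "cmod z ^ 2 = R ^ 2" using assms by simp
  hence "cnj z * z = of_real (R ^ 2)"
    by (metis complex_norm_square mult.commute)
  hence "(of_real R - cnj r * z / of_real R) * of_real R = cnj (z - r) * z"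
    using assms by (simp add: field_simps power2_eq_square)
  hence "cmod (of_real R - cnj r * z / of_real R) * R = cmod (z - r) * R"
    using assms by (metis norm_mult complex_mod_cnj norm_of_real abs_of_pos)
  thus ?thesis using assms by simp
qed

text \<open>Circles of radius \<open>R > 1\<close> keep the reflected product zero-free up to the boundary,
  even when critical points lie on the unit circle.\<close>

lemma norm_le_reflected_critical_product_outer:
  fixes p :: "complex poly" and r :: "nat \<Rightarrow> complex" and R :: real
  assumes monic: "lead_coeff p = 1" and roots: "\<And>z. poly p z = 0 \<Longrightarrow> cmod z \<le> 1"
    and crit: "\<And>z. poly (pderiv p) z = degree p * (\<Prod>j<m. z - r j)"
    and r: "\<And>j. j < m \<Longrightarrow> cmod (r j) \<le> 1"
    and R: "R > 1" and z: "cmod z \<le> 1"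
  shows "cmod (degree p * poly p z - z * poly (pderiv p) z)
           \<le> R * degree p * cmod (\<Prod>j<m. of_real R - cnj (r j) * z / of_real R)"
proof -
  define Q where "Q = (\<lambda>z. \<Prod>j<m. of_real R - cnj (r j) * z / of_real R)"
  define h where "h = (\<lambda>z. (degree p * poly p z - z * poly (pderiv p) z) / Q z)"
  have Qnz: "Q z \<noteq> 0" if "cmod z \<le> R" for z
  proof -
    have "of_real R - cnj (r j) * z / of_real R \<noteq> 0" if j: "j < m" for j
    proof
      assume "of_real R - cnj (r j) * z / of_real R = 0"
      hence "cnj (r j) * z = of_real R * of_real R" using R by (simp add: field_simps)
      hence "cmod (r j) * cmod z = R * R" using R
        by (metis norm_mult complex_mod_cnj norm_of_real abs_of_pos less_trans zero_less_one)
      moreover have "cmod (r j) * cmod z \<le> 1 * R"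
        using r[OF j] \<open>cmod z \<le> R\<close> by (intro mult_mono) auto
      ultimately show False using R by simp
    qed
    thus ?thesis by (simp add: Q_def)
  qed
  have "cmod (h z) \<le> R * degree p"
  proof (rule maximum_modulus_frontier[where S = "cball 0 R" and f = h and \<xi> = z])
    show "h holomorphic_on interior (cball 0 R)"
      unfolding h_def using Qnz by (auto simp: Q_def intro!: holomorphic_intros)
    show "continuous_on (closure (cball 0 R)) h"
      unfolding h_def using Qnz by (auto simp: Q_def intro!: continuous_intros)
    show "z \<in> cball 0 R" using z R by simp
  next
    fix y assume "y \<in> frontier (cball (0::complex) R)"
    hence y: "cmod y = R" using R by simp
    have Q: "cmod (Q y) = cmod (\<Prod>j<m. y - r j)"
      using norm_reflected_linear_factor[OF y] R by (simp add: Q_def flip: prod_norm)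
    have "cmod (degree p * poly p y - y * poly (pderiv p) y) \<le> cmod (y * poly (pderiv p) y)"
      by (rule norm_polar_deriv_le[OF monic roots]) (use y R in auto)
    also have "\<dots> = R * degree p * cmod (Q y)"
      using y by (simp add: crit Q norm_mult)
    finally show "cmod (h y) \<le> R * degree p"
      using Qnz[of y] y by (simp add: h_def norm_divide divide_le_eq)
  qed auto
  thus ?thesis
    using Qnz[of z] z R by (simp add: h_def norm_divide divide_le_eq Q_def)
qed

text \<open>Letting \<open>R\<close> decrease to 1 bounds \<open>n p - z p'\<close> by
  \<open>n\<close> times the reflected product. The term \<open>z p'\<close> obeys the same bound
  factor by factor, and adding the two produces the constant 2.\<close>

lemma norm_le_reflected_critical_product:
  fixes p :: "complex poly" and r :: "nat \<Rightarrow> complex"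
  assumes monic: "lead_coeff p = 1" and roots: "\<And>z. poly p z = 0 \<Longrightarrow> cmod z \<le> 1"
    and deg: "degree p > 0"
    and crit: "\<And>z. poly (pderiv p) z = degree p * (\<Prod>j<m. z - r j)"
    and r: "\<And>j. j < m \<Longrightarrow> cmod (r j) \<le> 1"
    and z: "cmod z \<le> 1"
  shows "cmod (poly p z) \<le> 2 * cmod (\<Prod>j<m. 1 - cnj (r j) * z)"
proof -
  let ?B = "cmod (\<Prod>j<m. 1 - cnj (r j) * z)"
  have lim: "((\<lambda>R::real. R * degree p * cmod (\<Prod>j<m. of_real R - cnj (r j) * z / of_real R))
      \<longlongrightarrow> 1 * real (degree p) * cmod (\<Prod>j<m. of_real 1 - cnj (r j) * z / of_real 1)) (at_right 1)"
    by (intro tendsto_mult tendsto_norm tendsto_prod tendsto_diff tendsto_divide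
        tendsto_const tendsto_of_real tendsto_ident_at) auto
  have "eventually (\<lambda>R::real. cmod (degree p * poly p z - z * poly (pderiv p) z)
      \<le> R * degree p * cmod (\<Prod>j<m. of_real R - cnj (r j) * z / of_real R)) (at_right 1)"
    using eventually_at_right_less[of "1::real"]
    by (rule eventually_mono)
      (rule norm_le_reflected_critical_product_outer[OF monic roots crit r _ z])
  from tendsto_lowerbound[OF lim this]
  have "cmod (degree p * poly p z - z * poly (pderiv p) z) \<le> degree p * ?B"
    by simp
  moreover have "cmod (z * poly (pderiv p) z) \<le> degree p * ?B"
  proof -
    have "(\<Prod>j<m. cmod (z - r j)) \<le> (\<Prod>j<m. cmod (1 - cnj (r j) * z))"
      using r z by (intro prod_mono) (auto intro: norm_diff_le_norm_one_minus_cnj)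
    hence "cmod z * (\<Prod>j<m. cmod (z - r j)) \<le> 1 * (\<Prod>j<m. cmod (1 - cnj (r j) * z))"
      using z by (intro mult_mono prod_nonneg) auto
    hence "degree p * (cmod z * (\<Prod>j<m. cmod (z - r j))) \<le> degree p * (\<Prod>j<m. cmod (1 - cnj (r j) * z))"
      by (intro mult_left_mono) auto
    thus ?thesis by (simp add: crit norm_mult prod_norm mult_ac)
  qed
  ultimately have "cmod (degree p * poly p z) \<le> degree p * (2 * ?B)"
    using norm_triangle_ineq[of "degree p * poly p z - z * poly (pderiv p) z" "z * poly (pderiv p) z"]
    by simp
  thus ?thesis using deg by (simp add: norm_mult)
qed

section \<open>Elementary estimates and the choice of a descent direction\<close>

text \<open>The difference of the two sides has derivative \<open>x ^ 3 / (1 + x)\<close>, which has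
  the sign of \<open>x\<close>, so its minimum is the value 0 at 0.\<close>

lemma ln_add_one_le_cubic:
  fixes t :: real
  assumes "t > -1"
  shows "ln (1 + t) \<le> t - t\<^sup>2 / 2 + t ^ 3 / 3"
proof -
  define h where "h = (\<lambda>t::real. t - t\<^sup>2 / 2 + t ^ 3 / 3 - ln (1 + t))"
  have deriv: "(h has_real_derivative x ^ 3 / (1 + x)) (at x)" if "x > -1" for x
    unfolding h_def using that
    by (auto intro!: derivative_eq_intros simp: divide_simps) (auto simp: power2_eq_square power3_eq_cube algebra_simps)
  have "h 0 \<le> h t"
  proof (cases "t \<ge> 0")
    case True
    thus ?thesis
      by (intro DERIV_nonneg_imp_nondecreasing[of 0 t h])
        (auto intro!: exI[of _ "_ ^ 3 / (1 + _)"] deriv divide_nonneg_nonneg)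
  next
    case False
    show ?thesis
    proof (rule DERIV_nonpos_imp_nonincreasing[of t 0 h])
      fix x assume "t \<le> x" "x \<le> 0"
      thus "\<exists>y. (h has_real_derivative y) (at x) \<and> y \<le> 0"
        using assms deriv[of x] by (intro exI[of _ "x ^ 3 / (1 + x)"] conjI divide_nonpos_nonneg) (auto simp: power_le_zero_eq)
    qed (use False in auto)
  qed
  thus ?thesis by (simp add: h_def)
qed

text \<open>Second-order expansion of \<open>ln (cmod (1 + y)) = ln (1 + t) / 2\<close> with
  \<open>t = 2 Re y + (cmod y)^2\<close>. The cubic remainder collects
  \<open>- u r^2 \<le> r^3\<close> and \<open>t^3 / 6 \<le> 3 r^3 / 2\<close>, which fit under
  \<open>3 r^3\<close>.\<close>

lemma norm_one_add_le_exp: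
  fixes y :: complex
  assumes "cmod y \<le> 1 / 16"
  shows "cmod (1 + y) \<le> exp (Re y - Re (y\<^sup>2) / 2 + 3 * cmod y ^ 3)"
proof -
  define u r t where "u = Re y" and "r = cmod y" and "t = 2 * u + r\<^sup>2"
  have r: "0 \<le> r" "r \<le> 1 / 16" and u: "\<bar>u\<bar> \<le> r"
    using assms abs_Re_le_cmod[of y] by (auto simp: u_def r_def)
  have r2: "r\<^sup>2 \<le> r / 16" using mult_left_mono[OF r(2) r(1)] by (simp add: power2_eq_square)
  have abs_t: "\<bar>t\<bar> \<le> 33 / 16 * r"
    unfolding t_def abs_le_iff using r2 u[unfolded abs_le_iff] zero_le_power2[of r] r by linarith
  have sq: "cmod (1 + y) ^ 2 = 1 + t"
    unfolding t_def u_def r_def cmod_power2 by (simp add: power2_eq_square algebra_simps)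
  have t: "t > -1" using abs_t r by auto
  have Re_sq: "Re (y\<^sup>2) = 2 * u\<^sup>2 - r\<^sup>2"
    unfolding u_def r_def cmod_power2 by (simp add: power2_eq_square)
  have t3: "t ^ 3 \<le> 9 * r ^ 3"
  proof -
    have "t ^ 3 \<le> \<bar>t\<bar> ^ 3" by (simp flip: power_abs)
    also have "\<dots> \<le> (33 / 16 * r) ^ 3" using abs_t by (intro power_mono) auto
    also have "\<dots> \<le> 9 * r ^ 3" using r by (simp add: power_mult_distrib power3_eq_cube)
    finally show ?thesis .
  qed
  have ur: "- (u * r\<^sup>2) \<le> r ^ 3"
    using mult_right_mono[of "- u" r "r\<^sup>2"] u[unfolded abs_le_iff]
    by (simp add: power3_eq_cube power2_eq_square mult.assoc)
  have "ln (1 + t) / 2 \<le> (t - t\<^sup>2 / 2 + t ^ 3 / 3) / 2"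
    using ln_add_one_le_cubic[OF t] by simp
  also have "\<dots> \<le> u - Re (y\<^sup>2) / 2 + 3 * r ^ 3"
  proof -
    have "t\<^sup>2 = 4 * u\<^sup>2 + 4 * (u * r\<^sup>2) + (r\<^sup>2)\<^sup>2"
      by (simp add: t_def power2_eq_square algebra_simps)
    thus ?thesis
      using t3 ur zero_le_power2[of "r\<^sup>2"] zero_le_power[OF r(1), of 3] t_def Re_sq by argo
  qed
  finally have "exp (ln (1 + t) / 2) \<le> exp (Re y - Re (y\<^sup>2) / 2 + 3 * cmod y ^ 3)"
    by (simp add: u_def r_def)
  moreover have "cmod (1 + y) = exp (ln (1 + t) / 2)"
  proof -
    have "exp (ln (1 + t) / 2) ^ 2 = 1 + t"
      using t by (simp flip: exp_double)
    thus ?thesis using sq by (metis norm_ge_zero exp_ge_zero power2_eq_imp_eq)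
  qed
  ultimately show ?thesis by simp
qed

text \<open>The direction is a primitive cube root of unity, with the sign of its imaginary part
  chosen to match \<open>Im S\<close>. The second and third properties make the quadratic and linear
  terms of \<open>ln |P|\<close> decrease; the last keeps \<open>S + m s e\<close> away from 0 for
  \<open>s \<ge> 0\<close>.\<close>

lemma descent_direction:
  fixes S :: complex
  assumes "Re S \<ge> 0"
  obtains e where "cmod e = 1" "Re (e\<^sup>2) = - (1 / 2)" "Re (S * e) \<le> - (cmod S / 2)" "Re (S * cnj e) \<ge> - (cmod S / 2)"
proof -
  define c :: real where "c = (if Im S \<ge> 0 then 1 else -1)"
  define e where "e = Complex (- (1 / 2)) (c * sqrt 3 / 2)"
  have c: "c\<^sup>2 = 1" "c * Im S = \<bar>Im S\<bar>" by (auto simp: c_def)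
  have "cmod e ^ 2 = 1" by (simp add: cmod_power2 e_def power_divide power_mult_distrib c)
  hence "cmod e = 1" by (metis norm_ge_zero one_power2 power2_eq_imp_eq zero_le_one)
  moreover have "Re (e\<^sup>2) = - (1 / 2)"
    by (simp add: e_def power2_eq_square c_def)
  moreover have "Re (S * e) = - (Re S / 2 + \<bar>Im S\<bar> * sqrt 3 / 2)"
    using c by (simp add: e_def algebra_simps)
  moreover have "cmod S / 2 \<le> Re S / 2 + \<bar>Im S\<bar> * sqrt 3 / 2"
  proof (rule power2_le_imp_le)
    have "Re S * (\<bar>Im S\<bar> * sqrt 3) \<ge> 0" using assms by auto
    thus "(cmod S / 2)\<^sup>2 \<le> (Re S / 2 + \<bar>Im S\<bar> * sqrt 3 / 2)\<^sup>2"
      by (simp add: power_divide cmod_power2 power2_sum power_mult_distrib)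
  qed (use assms in auto)
  moreover have "Re (S * cnj e) = - (Re S / 2) + \<bar>Im S\<bar> * sqrt 3 / 2"
    using c by (simp add: e_def algebra_simps)
  moreover have "Re S \<le> cmod S" by (rule complex_Re_le_cmod)
  ultimately show thesis by (intro that[of e]) auto
qed

section \<open>Geometry of critical points that avoid the disc around \<open>a\<close>\<close>

text \<open>Here \<open>r\<close> lists the critical points of a polynomial \<open>f\<close> of
  degree \<open>m + 1\<close>. The bound on \<open>a\<close> yields
  \<open>4 * a * Re S \<le> m / 2 ^ 14\<close>, a quarter of the decay exponent
  \<open>m / 4096\<close> found in \<open>degree_bound_descent\<close>.\<close>

locale critical_free_disc =
  fixes m :: nat and r :: "nat \<Rightarrow> complex" and a :: real and f :: "complex \<Rightarrow> complex"
  assumes m_pos: "m > 0" and a_nonneg: "0 \<le> a" and a_le: "a \<le> 1 / 2 ^ 16"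
    and norm_r_le: "\<And>j. j < m \<Longrightarrow> cmod (r j) \<le> 1"
    and r_far: "\<And>j. j < m \<Longrightarrow> cmod (r j - of_real a) > 1"
    and f_deriv: "\<And>z. (f has_field_derivative of_nat (Suc m) * (\<Prod>j<m. z - r j)) (at z)"
    and f_a: "f (of_real a) = 0"
    and f_bound: "\<And>z. cmod z \<le> 1 \<Longrightarrow> cmod (f z) \<le> 2 * cmod (\<Prod>j<m. 1 - cnj (r j) * z)"
begin

definition w where "w j = 1 / (of_real a - r j)"
definition S where "S = (\<Sum>j<m. w j)"
definition P where "P z = (\<Prod>j<m. z - r j)"
text \<open>The logarithmic derivative \<open>P' / P\<close>, whose value at \<open>a\<close> is
  \<open>S\<close>.\<close>

definition G where "G z = (\<Sum>j<m. 1 / (z - r j))"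

lemma w_mult: "j < m \<Longrightarrow> w j * (of_real a - r j) = 1"
  using r_far[of j] by (auto simp: w_def)

lemma norm_w: "j < m \<Longrightarrow> 0 < cmod (w j) \<and> cmod (w j) < 1"
  using r_far[of j] by (auto simp: w_def norm_divide norm_minus_commute divide_less_eq)

text \<open>Squared moduli in \<open>r j * w j = a * w j - 1\<close>; this translates the position
  of \<open>r j\<close> relative to the unit circle into a condition on \<open>w j\<close>.\<close>

lemma norm_r_w:
  assumes "j < m"
  shows "(1 - cmod (r j) ^ 2) * cmod (w j) ^ 2 = cmod (w j) ^ 2 - a\<^sup>2 * cmod (w j) ^ 2 + 2 * a * Re (w j) - 1"
proof -
  have "r j * w j = of_real a * w j - 1"
    using w_mult[OF assms] by (simp add: algebra_simps)
  hence "cmod (r j) ^ 2 * cmod (w j) ^ 2 = cmod (of_real a * w j - 1) ^ 2"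
    by (metis norm_mult power_mult_distrib)
  also have "\<dots> = a\<^sup>2 * cmod (w j) ^ 2 - 2 * a * Re (w j) + 1"
    unfolding cmod_power2 by (simp add: power2_eq_square algebra_simps)
  finally show ?thesis by (simp add: algebra_simps)
qed

lemma norm_w_defect:
  assumes "j < m"
  shows "1 - cmod (w j) ^ 2 \<le> 2 * a * Re (w j) - a\<^sup>2 * cmod (w j) ^ 2"
proof -
  have "(1 - cmod (r j) ^ 2) * cmod (w j) ^ 2 \<ge> 0"
    using norm_r_le[OF assms] by (intro mult_nonneg_nonneg) (auto simp: power_le_one)
  thus ?thesis unfolding norm_r_w[OF assms] by simp
qed

lemma norm_w_sq: "j < m \<Longrightarrow> cmod (w j) ^ 2 < 1"
  using norm_w[of j] by (simp add: power_less_one_iff)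

lemma a_pos: "a > 0"
proof (rule ccontr)
  assume "\<not> a > 0"
  hence "a = 0" using a_nonneg by simp
  thus False using norm_w_defect[OF m_pos] norm_w_sq[OF m_pos] by simp
qed

text \<open>Since \<open>a \<le> 1\<close>, the defect \<open>1 - |w|^2\<close> is at least
  \<open>a^2 (1 - |w|^2)\<close>. Comparing with its upper bound in \<open>norm_w_defect\<close>
  leaves \<open>a^2 \<le> 2 a Re w\<close>, and \<open>a\<close> is positive.\<close>

lemma a_le_Re_w:
  assumes "j < m"
  shows "a \<le> 2 * Re (w j)"
proof -
  have "(1 - a\<^sup>2) * (1 - cmod (w j) ^ 2) \<ge> 0"
    using norm_w_sq[OF assms] a_nonneg a_le by (intro mult_nonneg_nonneg) (auto intro: power_le_one)
  hence "a * a \<le> a * (2 * Re (w j))"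
    using norm_w_defect[OF assms] by (simp add: power2_eq_square algebra_simps)
  thus ?thesis using a_pos by simp
qed

lemma Re_w_nonneg: "j < m \<Longrightarrow> 0 \<le> Re (w j)"
  using a_le_Re_w[of j] a_nonneg by simp

lemma norm_r_w_le:
  assumes "j < m"
  shows "(1 - cmod (r j) ^ 2) * cmod (w j) ^ 2 \<le> 2 * a * Re (w j)"
  using norm_r_w[OF assms] norm_w_sq[OF assms] mult_nonneg_nonneg[OF zero_le_power2[of a] zero_le_power2[of "cmod (w j)"]]
  by linarith

text \<open>From \<open>w^2 + |w|^2 = 2 (Re w) w\<close>: when \<open>Re w\<close> is small,
  \<open>w\<close> is close to \<open>\<i>\<close> or \<open>- \<i>\<close>, because its modulus is
  almost 1.\<close>

lemma norm_w_sq_add_one: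
  assumes "j < m"
  shows "cmod ((w j)\<^sup>2 + 1) \<le> 4 * Re (w j)"
proof -
  have "(w j)\<^sup>2 + 1 = of_real (2 * Re (w j)) * w j + of_real (1 - cmod (w j) ^ 2)"
    by (simp add: complex_eq_iff cmod_power2) (simp add: power2_eq_square algebra_simps)
  hence "cmod ((w j)\<^sup>2 + 1) \<le> cmod (of_real (2 * Re (w j)) * w j) + cmod (of_real (1 - cmod (w j) ^ 2))"
    by (metis norm_triangle_ineq)
  also have "\<dots> = 2 * Re (w j) * cmod (w j) + (1 - cmod (w j) ^ 2)"
    using norm_w_sq[OF assms] Re_w_nonneg[OF assms] by (simp add: norm_mult del: of_real_diff of_real_mult)
  also have "2 * Re (w j) * cmod (w j) \<le> 2 * Re (w j) * 1"
    using norm_w[OF assms] Re_w_nonneg[OF assms] by (intro mult_left_mono) auto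
  also have "1 - cmod (w j) ^ 2 \<le> 2 * a * Re (w j)"
    using norm_w_defect[OF assms] mult_nonneg_nonneg[OF zero_le_power2[of a] zero_le_power2[of "cmod (w j)"]] by linarith
  also have "2 * a * Re (w j) \<le> 2 * 1 * Re (w j)"
    using a_le Re_w_nonneg[OF assms] by (intro mult_right_mono mult_left_mono) auto
  finally show ?thesis by simp
qed

lemma Re_S: "Re S = (\<Sum>j<m. Re (w j))"
  by (simp add: S_def)

lemma Re_S_nonneg: "0 \<le> Re S"
  unfolding Re_S by (intro sum_nonneg Re_w_nonneg) auto

lemma a_le_Re_S: "a * m \<le> 2 * Re S"
proof -
  have "(\<Sum>j<m. a) \<le> (\<Sum>j<m. 2 * Re (w j))"
    by (intro sum_mono a_le_Re_w) auto
  thus ?thesis by (simp add: Re_S sum_distrib_left mult.commute)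
qed

lemma norm_S_le: "cmod S \<le> m"
proof -
  have "cmod S \<le> (\<Sum>j<m. 1)"
    unfolding S_def by (rule sum_norm_le) (use norm_w in \<open>auto intro: less_imp_le\<close>)
  thus ?thesis by simp
qed

lemma Re_S_le_norm: "Re S \<le> cmod S"
  by (rule complex_Re_le_cmod)

lemma S_pos: "cmod S > 0"
proof -
  have "0 < a * m" using a_pos m_pos by simp
  thus ?thesis using a_le_Re_S Re_S_le_norm by linarith
qed

lemma norm_sum_w_sq:
  "cmod ((\<Sum>j<m. (w j)\<^sup>2) + m) \<le> 4 * Re S"
proof -
  have "(\<Sum>j<m. (w j)\<^sup>2) + m = (\<Sum>j<m. (w j)\<^sup>2 + 1)"
    by (simp add: sum.distrib)
  also have "cmod \<dots> \<le> (\<Sum>j<m. 4 * Re (w j))"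
    by (rule sum_norm_le) (use norm_w_sq_add_one in auto)
  finally show ?thesis by (simp add: Re_S sum_distrib_left)
qed

section \<open>Local expansions of \<open>P\<close> and \<open>G\<close> near
  \<open>a\<close>\<close>

lemma diff_r_eq:
  assumes "j < m"
  shows "of_real a + x - r j = (of_real a - r j) * (1 + w j * x)"
  using w_mult[OF assms] by (simp add: algebra_simps)

lemma norm_w_x_le:
  assumes "j < m"
  shows "cmod (w j * x) \<le> cmod x"
  using norm_w[OF assms] mult_right_mono[of "cmod (w j)" 1 "cmod x"] by (simp add: norm_mult)

lemma norm_one_add_w_x:
  assumes "j < m" "cmod x \<le> 1 / 2"
  shows "cmod (1 + w j * x) \<ge> 1 / 2"
  using norm_w_x_le[OF assms(1), of x] norm_diff_ineq[of 1 "w j * x"] assms by simp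

lemma norm_diff_r_ge:
  assumes "j < m" "cmod (z - of_real a) \<le> 1 / 2"
  shows "cmod (z - r j) \<ge> 1 / 2"
proof -
  have "cmod (r j - of_real a) \<le> cmod (z - of_real a) + cmod (z - r j)"
    using norm_triangle_ineq[of "z - of_real a" "r j - z"] by (simp add: norm_minus_commute)
  thus ?thesis using r_far[OF assms(1)] assms(2) by simp
qed

lemma P_nonzero: "cmod (z - of_real a) \<le> 1 / 2 \<Longrightarrow> P z \<noteq> 0"
  unfolding P_def using norm_diff_r_ge[of _ z] by fastforce

lemma P_deriv:
  assumes "cmod (z - of_real a) \<le> 1 / 2"
  shows "(P has_field_derivative P z * G z) (at z)"
  unfolding P_def[abs_def] G_def
  by (rule deriv_prod_linear) (use norm_diff_r_ge[OF _ assms] in fastforce)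

lemma G_deriv:
  assumes "cmod (z - of_real a) \<le> 1 / 2"
  shows "(G has_field_derivative - (\<Sum>j<m. 1 / (z - r j)\<^sup>2)) (at z)"
proof -
  have "z - r j \<noteq> 0" if "j < m" for j
    using norm_diff_r_ge[OF that assms] by auto
  thus ?thesis
    unfolding G_def[abs_def]
    by (auto intro!: derivative_eq_intros simp: sum_negf[symmetric] power2_eq_square)
qed

lemma norm_G_deriv_le:
  assumes "cmod (z - of_real a) \<le> 1 / 2"
  shows "cmod (- (\<Sum>j<m. 1 / (z - r j)\<^sup>2)) \<le> 4 * m"
proof -
  have "cmod (\<Sum>j<m. 1 / (z - r j)\<^sup>2) \<le> (\<Sum>j<m. 4)"
  proof (rule sum_norm_le)
    fix j assume "j \<in> {..<m}"
    hence "cmod (z - r j) \<ge> 1 / 2" using norm_diff_r_ge assms by auto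
    hence "cmod (z - r j) ^ 2 \<ge> (1 / 2) ^ 2" by (intro power_mono) auto
    thus "cmod (1 / (z - r j)\<^sup>2) \<le> 4"
      by (simp add: norm_divide norm_power divide_le_eq power_divide) 
  qed
  thus ?thesis by simp
qed

lemma G_at_a: "G (of_real a) = S"
  by (simp add: G_def S_def w_def)

text \<open>Each summand is \<open>w / (1 + w x)\<close>, expanded to first order with remainder
  \<open>w (w x)^2 / (1 + w x)\<close>. Replacing the sum of \<open>w^2\<close> by
  \<open>- m\<close> costs the term with \<open>cmod S\<close>.\<close>

lemma norm_G_expansion:
  assumes x: "cmod x \<le> 1 / 2"
  shows "cmod (G (of_real a + x) - (S + of_nat m * x)) \<le> 4 * cmod S * cmod x + 2 * m * cmod x ^ 2"
proof -
  have pointwise: "cmod (1 / (of_real a + x - r j) - w j + (w j)\<^sup>2 * x) \<le> 2 * cmod x ^ 2" if j: "j < m" for j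
  proof -
    have nz: "1 + w j * x \<noteq> 0" using norm_one_add_w_x[OF j x] by auto
    have "1 / (of_real a + x - r j) = w j / (1 + w j * x)"
      unfolding diff_r_eq[OF j] by (simp add: w_def)
    hence "1 / (of_real a + x - r j) - w j + (w j)\<^sup>2 * x = w j * (w j * x)\<^sup>2 / (1 + w j * x)"
      using nz by (simp add: field_simps power2_eq_square)
    also have "cmod \<dots> = cmod (w j) * cmod (w j * x) ^ 2 / cmod (1 + w j * x)"
      by (simp add: norm_divide norm_mult norm_power)
    also have "\<dots> \<le> 1 * cmod x ^ 2 / (1 / 2)"
      using norm_w[OF j] norm_w_x_le[OF j] norm_one_add_w_x[OF j x]
      by (intro frac_le mult_mono power_mono) auto
    finally show ?thesis by simp
  qed
  define T where "T = (\<Sum>j<m. 1 / (of_real a + x - r j) - w j + (w j)\<^sup>2 * x)"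
  define V where "V = (\<Sum>j<m. (w j)\<^sup>2) + m"
  have "G (of_real a + x) - (S + of_nat m * x) = T - V * x"
    by (simp add: T_def V_def G_def S_def sum.distrib sum_subtractf sum_distrib_right ring_distribs)
  hence "cmod (G (of_real a + x) - (S + of_nat m * x)) \<le> cmod T + cmod (V * x)"
    by (metis norm_triangle_ineq4)
  moreover have "cmod T \<le> (\<Sum>j<m. 2 * cmod x ^ 2)"
    unfolding T_def by (intro sum_norm_le pointwise) simp
  moreover have "cmod V * cmod x \<le> 4 * cmod S * cmod x"
    using norm_sum_w_sq Re_S_le_norm unfolding V_def by (intro mult_right_mono) auto
  ultimately show ?thesis by (simp add: norm_mult)
qed

text \<open>Apply \<open>norm_one_add_le_exp\<close> to every factor of
  \<open>P (a + x) / P a\<close>, the product of the \<open>1 + w j * x\<close>. The quadratic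
  coefficient, minus half the sum of \<open>w^2\<close>, is \<open>m / 2\<close> up to
  \<open>2 * cmod S\<close>.\<close>

lemma norm_P_le:
  assumes x: "cmod x \<le> 1 / 16"
  shows "cmod (P (of_real a + x)) \<le>
    cmod (P (of_real a)) * exp (Re (S * x) + m * Re (x\<^sup>2) / 2 + 2 * cmod S * cmod x ^ 2 + 3 * m * cmod x ^ 3)"
proof -
  define E where "E = (\<lambda>j. Re (w j * x) - Re ((w j * x)\<^sup>2) / 2 + 3 * cmod x ^ 3)"
  have fac: "cmod (1 + w j * x) \<le> exp (E j)" if j: "j < m" for j
  proof -
    have le: "cmod (w j * x) \<le> cmod x" by (rule norm_w_x_le[OF j])
    hence "cmod (1 + w j * x) \<le> exp (Re (w j * x) - Re ((w j * x)\<^sup>2) / 2 + 3 * cmod (w j * x) ^ 3)"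
      using x by (intro norm_one_add_le_exp) simp
    also have "\<dots> \<le> exp (E j)"
      unfolding E_def using le by (simp add: power_mono)
    finally show ?thesis .
  qed
  have "P (of_real a + x) = P (of_real a) * (\<Prod>j<m. 1 + w j * x)"
    unfolding P_def prod.distrib[symmetric] by (rule prod.cong) (auto simp: diff_r_eq)
  hence "cmod (P (of_real a + x)) = cmod (P (of_real a)) * (\<Prod>j<m. cmod (1 + w j * x))"
    by (simp add: norm_mult prod_norm)
  also have "\<dots> \<le> cmod (P (of_real a)) * (\<Prod>j<m. exp (E j))"
    using fac by (intro mult_left_mono prod_mono) auto
  also have "\<dots> = cmod (P (of_real a)) * exp (\<Sum>j<m. E j)"
    by (simp add: exp_sum)
  also have "(\<Sum>j<m. E j) \<le> Re (S * x) + m * Re (x\<^sup>2) / 2 + 2 * cmod S * cmod x ^ 2 + 3 * m * cmod x ^ 3"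
  proof -
    define V where "V = (\<Sum>j<m. (w j)\<^sup>2) + m"
    have "(\<Sum>j<m. E j) = Re (\<Sum>j<m. w j * x) - Re (\<Sum>j<m. (w j * x)\<^sup>2) / 2 + 3 * m * cmod x ^ 3"
      by (simp add: E_def sum.distrib sum_subtractf sum_divide_distrib)
    also have "(\<Sum>j<m. w j * x) = S * x" by (simp add: S_def sum_distrib_right)
    also have "(\<Sum>j<m. (w j * x)\<^sup>2) = V * x\<^sup>2 - of_nat m * x\<^sup>2"
      by (simp add: V_def power_mult_distrib sum_distrib_right ring_distribs)
    finally have eq: "(\<Sum>j<m. E j) = Re (S * x) - Re (V * x\<^sup>2) / 2 + m * Re (x\<^sup>2) / 2 + 3 * m * cmod x ^ 3"
      by (simp add: diff_divide_distrib)
    have "- Re (V * x\<^sup>2) \<le> cmod (V * x\<^sup>2)" using abs_Re_le_cmod[of "V * x\<^sup>2"] by simp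
    also have "\<dots> = cmod V * cmod x ^ 2" by (simp add: norm_mult norm_power)
    also have "\<dots> \<le> (4 * cmod S) * cmod x ^ 2"
      using norm_sum_w_sq Re_S_le_norm unfolding V_def by (intro mult_right_mono) auto
    finally show ?thesis using eq by linarith
  qed
  finally show ?thesis by (simp add: mult_left_mono)
qed

section \<open>Growth of \<open>f\<close> near \<open>a\<close> and the two bounds on the
  degree\<close>

text \<open>The squares of \<open>|1 - cnj r z|\<close> and \<open>|z - r|\<close> differ by at most
  \<open>1 - |r|^2\<close>. By \<open>norm_r_w_le\<close> and \<open>|w| |z - r| \<ge> 1 / 2\<close>
  this is at most \<open>8 a (Re w) |z - r|^2\<close>, hence an exponential factor for each critical
  point.\<close>

lemma norm_f_le:
  assumes z: "cmod (z - of_real a) \<le> 1 / 2"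
  shows "cmod (f z) \<le> 2 * cmod (P z) * exp (4 * a * Re S)"
proof -
  have z1: "cmod z \<le> 1"
    using norm_triangle_sub[of z "of_real a"] z a_le a_nonneg by simp
  have fac: "cmod (1 - cnj (r j) * z) \<le> cmod (z - r j) * exp (4 * a * Re (w j))" if j: "j < m" for j
  proof (rule power2_le_imp_le)
    let ?y = "1 + w j * (z - of_real a)"
    have "z - r j = (of_real a - r j) * ?y" using diff_r_eq[OF j, of "z - of_real a"] by simp
    hence "w j * (z - r j) = ?y" using w_mult[OF j] by (metis mult.assoc mult_1)
    hence y: "cmod (w j) * cmod (z - r j) = cmod ?y" by (metis norm_mult)
    have "(1 / 2)\<^sup>2 \<le> (cmod (w j) * cmod (z - r j))\<^sup>2"
      unfolding y using norm_one_add_w_x[OF j z] by (intro power_mono) auto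
    hence "1 \<le> 4 * (cmod (w j) ^ 2 * cmod (z - r j) ^ 2)"
      by (simp add: power_divide power_mult_distrib)
    hence "2 * a * Re (w j) * 1 \<le> 2 * a * Re (w j) * (4 * (cmod (w j) ^ 2 * cmod (z - r j) ^ 2))"
      using a_nonneg Re_w_nonneg[OF j] by (intro mult_left_mono) auto
    hence "(1 - cmod (r j) ^ 2) * cmod (w j) ^ 2 \<le> 8 * a * Re (w j) * cmod (z - r j) ^ 2 * cmod (w j) ^ 2"
      using norm_r_w_le[OF j] by (simp add: mult_ac)
    hence *: "1 - cmod (r j) ^ 2 \<le> 8 * a * Re (w j) * cmod (z - r j) ^ 2"
      using norm_w[OF j] by simp
    have "cmod (1 - cnj (r j) * z) ^ 2 = cmod (z - r j) ^ 2 + (1 - cmod z ^ 2) * (1 - cmod (r j) ^ 2)"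
      by (simp only: cmod_power2) (simp add: power2_eq_square algebra_simps)
    also have "(1 - cmod z ^ 2) * (1 - cmod (r j) ^ 2) \<le> 1 * (1 - cmod (r j) ^ 2)"
      using norm_r_le[OF j] by (intro mult_right_mono) (auto simp: power_le_one)
    also have "\<dots> \<le> 8 * a * Re (w j) * cmod (z - r j) ^ 2" using * by simp
    also have "cmod (z - r j) ^ 2 + 8 * a * Re (w j) * cmod (z - r j) ^ 2
        = cmod (z - r j) ^ 2 * (1 + 8 * a * Re (w j))" by (simp add: algebra_simps)
    also have "\<dots> \<le> cmod (z - r j) ^ 2 * exp (8 * a * Re (w j))"
      by (intro mult_left_mono exp_ge_add_one_self) auto
    also have "\<dots> = (cmod (z - r j) * exp (4 * a * Re (w j)))\<^sup>2"
      by (simp add: power_mult_distrib flip: exp_double)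
    finally show "cmod (1 - cnj (r j) * z) ^ 2 \<le> (cmod (z - r j) * exp (4 * a * Re (w j)))\<^sup>2"
      by simp
  qed simp
  have "cmod (f z) \<le> 2 * (\<Prod>j<m. cmod (1 - cnj (r j) * z))"
    using f_bound[OF z1] by (simp add: prod_norm)
  also have "\<dots> \<le> 2 * (\<Prod>j<m. cmod (z - r j) * exp (4 * a * Re (w j)))"
    using fac by (intro mult_left_mono prod_mono) auto
  also have "\<dots> = 2 * cmod (P z) * exp (4 * a * Re S)"
    by (simp add: prod.distrib P_def prod_norm exp_sum[symmetric] sum_distrib_left Re_S)
  finally show ?thesis .
qed

lemma degree_bound_degenerate:
  assumes "cmod S ^ 2 \<le> 512 * m"
  shows "real m \<le> 4 * exp 4096"
proof -
  define h where "h = (\<lambda>z. f z / P z)"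
  let ?M = "2 * exp (4 * a * Re S)"
  have deriv: "(h has_field_derivative (Suc m * P z * P z - f z * (P z * G z)) / (P z * P z)) (at z)"
    if "cmod (z - of_real a) \<le> 1 / 2" for z
    unfolding h_def using DERIV_divide[OF f_deriv P_deriv[OF that] P_nonzero[OF that]]
    by (simp add: P_def)
  have "(h has_field_derivative Suc m) (at (of_real a))"
    using deriv[of "of_real a"] P_nonzero[of "of_real a"] f_a by simp
  hence "deriv h (of_real a) = Suc m" by (rule DERIV_imp_deriv)
  hence "real (Suc m) = cmod ((deriv ^^ 1) h (of_real a))"
    by (simp del: of_nat_Suc)
  also have "\<dots> \<le> fact 1 * ?M / (1 / 2) ^ 1"
  proof (rule Cauchy_inequality)
    show "h holomorphic_on ball (of_real a) (1 / 2)"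
      unfolding holomorphic_on_open[OF open_ball]
      using deriv by (metis dist_commute dist_norm less_imp_le mem_ball)
    have "h field_differentiable at z within cball (of_real a) (1 / 2)" if "z \<in> cball (of_real a) (1 / 2)" for z
      using deriv[of z] that field_differentiable_at_within field_differentiable_def
      by (metis dist_commute dist_norm mem_cball)
    thus "continuous_on (cball (of_real a) (1 / 2)) h"
      by (meson field_differentiable_imp_continuous_at continuous_on_eq_continuous_within)
  next
    fix z assume "cmod (of_real a - z) = 1 / 2"
    hence z: "cmod (z - of_real a) \<le> 1 / 2" by (simp add: norm_minus_commute)
    show "cmod (h z) \<le> ?M"
      using norm_f_le[OF z] P_nonzero[OF z] by (simp add: h_def norm_divide divide_le_eq mult_ac)
  qed simp
  \<comment> \<open>As \<open>a m \<le> 2 Re S\<close>, the product \<open>m (4 a Re S)\<close> is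
    at most \<open>8 (Re S)^2 \<le> 8 * 512 m\<close>.\<close>
  also have "4 * a * Re S \<le> 4096"
  proof -
    have "Re S ^ 2 \<le> cmod S ^ 2"
      using Re_S_nonneg Re_S_le_norm by (intro power_mono) auto
    hence "m * (4 * a * Re S) \<le> m * 4096"
      using assms mult_right_mono[OF a_le_Re_S Re_S_nonneg] by (simp add: power2_eq_square mult_ac)
    thus ?thesis using m_pos by simp
  qed
  finally show ?thesis by simp
qed

text \<open>Along a ray on which \<open>P\<close> decays, \<open>f = \<integral> (m+1) P\<close> is governed by the endpoint contribution
  \<open>(m+1) P / G\<close> at \<open>a\<close>, as one integration by parts shows.\<close>

lemma degree_bound_descent:
  assumes large: "cmod S ^ 2 > 512 * m"
  shows "real m \<le> 2000000"
proof -
  obtain e where e: "cmod e = 1" "Re (e\<^sup>2) = - (1 / 2)" "Re (S * e) \<le> - (cmod S / 2)"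
      "Re (S * cnj e) \<ge> - (cmod S / 2)"
    using descent_direction[OF Re_S_nonneg] by blast
  define B where "B = cmod S"
  define p where "p = cmod (P (of_real a))"
  define n :: real where "n = real (Suc m)"
  define x where "x = (\<lambda>s::real. of_real s * e)"
  define \<gamma> where "\<gamma> = (\<lambda>s. of_real a + x s)"
  \<comment> \<open>Since \<open>P' = P G\<close>, the main term \<open>n P\<close> of the
    derivative cancels and \<open>F' = n P G' / G^2\<close> remains; moreover
    \<open>F a = - n P(a) / S\<close>.\<close>
  define F where "F = (\<lambda>z. f z - of_real n * P z / G z)"
  define dG where "dG = (\<lambda>z. - (\<Sum>j<m. 1 / (z - r j)\<^sup>2))"
  have B: "B > 0" using S_pos by (simp add: B_def)
  have p: "p > 0" using P_nonzero[of "of_real a"] by (simp add: p_def)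
  have nx: "cmod (x s) = s" if "0 \<le> s" for s using that e by (simp add: x_def norm_mult)
  have near: "cmod (\<gamma> s - of_real a) \<le> 1 / 2" if "0 \<le> s" "s \<le> 1 / 16" for s
    using nx[of s] that by (simp add: \<gamma>_def)
  have G_ge: "cmod (G (\<gamma> s)) \<ge> (B + m * s) / 4" if s: "0 \<le> s" "s \<le> 1 / 16" for s :: real
  proof -
    \<comment> \<open>Law of cosines: the angle between \<open>S\<close> and \<open>e\<close> is at
      most 120 degrees, so the squared length is at least \<open>B^2 + t^2 - t B\<close> with
      \<open>t = m s\<close>.\<close>
    have "(B + m * s) / 2 \<le> cmod (S + of_nat m * x s)"
    proof (rule power2_le_imp_le)
      have e1: "Re e ^ 2 + Im e ^ 2 = 1" using e(1) by (metis cmod_power2 one_power2)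
      have "cmod (S + of_nat m * x s) ^ 2
          = cmod S ^ 2 + (m * s)\<^sup>2 * (Re e ^ 2 + Im e ^ 2) + 2 * (m * s) * Re (S * cnj e)"
        unfolding cmod_power2 by (simp add: x_def power2_eq_square algebra_simps)
      moreover have "2 * (m * s) * Re (S * cnj e) \<ge> 2 * (m * s) * - (cmod S / 2)"
        using e(4) s by (intro mult_left_mono) auto
      ultimately have "cmod (S + of_nat m * x s) ^ 2 \<ge> B\<^sup>2 + (m * s)\<^sup>2 - (m * s) * B"
        unfolding e1 B_def by simp
      moreover have "B\<^sup>2 + (m * s)\<^sup>2 - (m * s) * B - ((B + m * s) / 2)\<^sup>2 = 3 / 4 * (B - m * s)\<^sup>2"
        by (simp add: power2_eq_square field_simps)
      moreover have "3 / 4 * (B - m * s)\<^sup>2 \<ge> 0" by simp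
      ultimately show "((B + m * s) / 2)\<^sup>2 \<le> cmod (S + of_nat m * x s) ^ 2" by linarith
    qed simp
    moreover have "cmod (G (\<gamma> s) - (S + of_nat m * x s)) \<le> 4 * B * s + 2 * real m * s\<^sup>2"
      using norm_G_expansion[of "x s"] nx[of s] s by (simp add: \<gamma>_def B_def)
    moreover have "cmod (S + of_nat m * x s) \<le> cmod (G (\<gamma> s)) + cmod (G (\<gamma> s) - (S + of_nat m * x s))"
      by (metis norm_minus_commute norm_triangle_sub)
    \<comment> \<open>The step length \<open>1 / 16\<close> keeps the expansion errors below
      \<open>B / 4\<close> and \<open>m s / 8\<close>, so half of the main term survives.\<close>
    moreover have "4 * B * s \<le> B / 4" using s mult_left_mono[of s "1 / 16" "4 * B"] B by simp
    moreover have "2 * real m * s\<^sup>2 \<le> m * s / 8"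
      using s mult_left_mono[of s "1 / 16" "2 * m * s"] by (simp add: power2_eq_square mult.commute)
    moreover have "0 \<le> m * s" using s by simp
    moreover have "(b + c) / 4 \<le> g"
      if "(b + c) / 2 \<le> h" "d \<le> u + v" "h \<le> g + d" "u \<le> b / 4" "v \<le> c / 8" "0 \<le> c"
      for b c d g h u v :: real
      using that by (simp add: field_simps)
    ultimately show ?thesis by blast
  qed
  have G_ge': "cmod (G (\<gamma> s)) \<ge> B / 4" if s: "0 \<le> s" "s \<le> 1 / 16" for s :: real
    using G_ge[OF s] mult_nonneg_nonneg[of "real m" s, OF _ s(1)] by simp
  \<comment> \<open>Along \<open>e\<close> the main terms are at most \<open>- B s / 2\<close> and
    \<open>- m s^2 / 4\<close>; the errors give back at most \<open>B s / 8\<close> and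
    \<open>3 m s^2 / 16\<close>.\<close>
  have P_le: "cmod (P (\<gamma> s)) \<le> p * exp (- (B * s / 4) - m * s\<^sup>2 / 16)" if s: "0 \<le> s" "s \<le> 1 / 16" for s :: real
  proof -
    have "Re (S * x s) = s * Re (S * e)" by (simp add: x_def algebra_simps)
    hence 1: "Re (S * x s) \<le> - (B * s / 2)"
      using mult_left_mono[OF e(3) s(1)] by (simp add: B_def mult.commute)
    have "(x s)\<^sup>2 = of_real (s\<^sup>2) * e\<^sup>2" by (simp add: x_def power_mult_distrib)
    hence 2: "m * Re ((x s)\<^sup>2) / 2 = - (m * s\<^sup>2 / 4)"
      using e(2) by (simp only: times_complex.sel Re_complex_of_real Im_complex_of_real) simp
    have 3: "2 * B * s\<^sup>2 \<le> B * s / 8"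
      using s B mult_left_mono[of s "1 / 16" "2 * B * s"] by (simp add: power2_eq_square)
    have 4: "3 * m * s ^ 3 \<le> 3 / 16 * (m * s\<^sup>2)"
      using s mult_left_mono[of s "1 / 16" "3 * m * s\<^sup>2"] by (simp add: power2_eq_square power3_eq_cube)
    have "cmod (P (\<gamma> s)) \<le> p * exp (Re (S * x s) + m * Re ((x s)\<^sup>2) / 2 + 2 * B * s\<^sup>2 + 3 * m * s ^ 3)"
      using norm_P_le[of "x s"] s by (simp add: nx \<gamma>_def p_def B_def)
    also have "\<dots> \<le> p * exp (- (B * s / 4) - m * s\<^sup>2 / 16)"
    proof -
      have "t + u + v + k \<le> - (b / 4) - c / 16"
        if "t \<le> - (b / 2)" "u = - (c / 4)" "v \<le> b / 8" "k \<le> 3 / 16 * c" "0 \<le> b" for t u v k b c :: real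
        using that by linarith
      from this[OF 1 2 3 4] show ?thesis using B s p by (intro mult_left_mono) auto
    qed
    finally show ?thesis .
  qed
  have F_deriv: "(F has_field_derivative of_real n * P (\<gamma> s) * dG (\<gamma> s) / (G (\<gamma> s))\<^sup>2) (at (\<gamma> s))"
    if s: "0 \<le> s" "s \<le> 1 / 16" for s :: real
  proof -
    have nz: "G (\<gamma> s) \<noteq> 0" using G_ge'[OF s] B by auto
    show ?thesis
      unfolding F_def dG_def
      by (rule derivative_eq_intros f_deriv P_deriv[OF near[OF s]] G_deriv[OF near[OF s]] nz refl)+
        (use nz in \<open>simp add: P_def n_def field_simps power2_eq_square\<close>)
  qed
  have path_deriv: "((F \<circ> \<gamma>) has_vector_derivative e * (of_real n * P (\<gamma> s) * dG (\<gamma> s) / (G (\<gamma> s))\<^sup>2)) (at s)"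
    if s: "0 \<le> s" "s \<le> 1 / 16" for s :: real
  proof (rule field_vector_diff_chain_at)
    show "(\<gamma> has_vector_derivative e) (at s)"
      unfolding \<gamma>_def x_def by (auto intro!: derivative_eq_intros)
  qed (rule F_deriv[OF s])
  \<comment> \<open>Chosen so that the derivative of \<open>\<Phi>\<close> equals the pointwise
    bound \<open>n p exp (- B s / 4) (4 m) / (B / 4)^2\<close> on the speed of \<open>F\<close>
    along the ray.\<close>
  define K where "K = 256 * n * m * p / B ^ 3"
  define \<Phi> where "\<Phi> = (\<lambda>s. - (K * exp (- (B * s / 4))))"
  have "cmod ((F \<circ> \<gamma>) (1 / 16) - (F \<circ> \<gamma>) 0) \<le> \<Phi> (1 / 16) - \<Phi> 0"
  proof (rule differentiable_bound_general)
    show "continuous_on {0..1 / 16} (F \<circ> \<gamma>)"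
      by (intro continuous_at_imp_continuous_on ballI has_vector_derivative_continuous[OF path_deriv]) auto
    show "continuous_on {0..1 / 16} \<Phi>" unfolding \<Phi>_def by (intro continuous_intros) auto
  next
    fix s :: real assume "0 < s" "s < 1 / 16"
    hence s: "0 \<le> s" "s \<le> 1 / 16" by auto
    show "((F \<circ> \<gamma>) has_vector_derivative e * (of_real n * P (\<gamma> s) * dG (\<gamma> s) / (G (\<gamma> s))\<^sup>2)) (at s)"
      by (rule path_deriv[OF s])
    show "(\<Phi> has_vector_derivative K * exp (- (B * s / 4)) * (B / 4)) (at s)"
      unfolding \<Phi>_def has_real_derivative_iff_has_vector_derivative[symmetric]
      by (auto intro!: derivative_eq_intros)
    have "cmod (e * (of_real n * P (\<gamma> s) * dG (\<gamma> s) / (G (\<gamma> s))\<^sup>2))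
        = n * cmod (P (\<gamma> s)) * cmod (dG (\<gamma> s)) / cmod (G (\<gamma> s)) ^ 2"
      using e by (simp add: norm_mult norm_divide norm_power n_def del: of_nat_Suc)
    also have "\<dots> \<le> n * (p * exp (- (B * s / 4))) * (4 * m) / (B / 4)\<^sup>2"
    proof (intro frac_le mult_mono power_mono)
      have "p * exp (- (B * s / 4) - m * s\<^sup>2 / 16) \<le> p * exp (- (B * s / 4))"
        using p by (intro mult_left_mono) auto
      thus "cmod (P (\<gamma> s)) \<le> p * exp (- (B * s / 4))" using P_le[OF s] by linarith
      show "cmod (dG (\<gamma> s)) \<le> 4 * m"
        unfolding dG_def by (rule norm_G_deriv_le[OF near[OF s]])
    qed (use B p G_ge'[OF s] in \<open>auto simp: n_def\<close>)
    also have "\<dots> = K * exp (- (B * s / 4)) * (B / 4)"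
      using B by (simp add: K_def field_simps power2_eq_square power3_eq_cube)
    finally show "cmod (e * (of_real n * P (\<gamma> s) * dG (\<gamma> s) / (G (\<gamma> s))\<^sup>2)) \<le> K * exp (- (B * s / 4)) * (B / 4)" .
  qed simp
  also have "\<dots> \<le> K"
    using B p by (simp add: \<Phi>_def K_def n_def)
  \<comment> \<open>The threshold 512 enters here: \<open>256 m / B^2 \<le> 1 / 2\<close>, so
    \<open>F\<close> changes by at most half of its initial modulus \<open>n p / B\<close>.\<close>
  also have "K \<le> n * p / (2 * B)"
  proof -
    have "512 * m \<le> B\<^sup>2" using large by (simp add: B_def)
    hence "n * p * (512 * m) \<le> n * p * B\<^sup>2"
      using p by (intro mult_left_mono) (auto simp: n_def)
    thus ?thesis using B by (simp add: K_def field_simps power2_eq_square power3_eq_cube)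
  qed
  finally have diff: "cmod (F (\<gamma> (1 / 16)) - F (\<gamma> 0)) \<le> n * p / (2 * B)" by simp
  define z where "z = \<gamma> (1 / 16)"
  define q where "q = cmod (P z)"
  have z: "cmod (z - of_real a) \<le> 1 / 2" unfolding z_def by (rule near) auto
  have F0: "cmod (F (\<gamma> 0)) = n * p / B"
    by (simp add: F_def \<gamma>_def x_def f_a G_at_a norm_mult norm_divide p_def B_def n_def del: of_nat_Suc)
  have aS: "a * Re S \<le> m / 2 ^ 16"
    using mult_mono[of a "1 / 2 ^ 16" "Re S" m] a_le a_nonneg norm_S_le Re_S_le_norm Re_S_nonneg by simp
  have q: "q \<le> p * exp (- (m / 4096))"
  proof -
    have "q \<le> p * exp (- (B * (1 / 16) / 4) - m * (1 / 16)\<^sup>2 / 16)"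
      unfolding q_def z_def by (rule P_le) auto
    also have "\<dots> \<le> p * exp (- (m / 4096))"
      using B p by (intro mult_left_mono) (auto simp: power2_eq_square)
    finally show ?thesis .
  qed
  have qexp: "q * exp (m / 2 ^ 14) \<le> p * exp (- (3 * m / 2 ^ 14))"
  proof -
    have "q * exp (m / 2 ^ 14) \<le> p * exp (- (m / 4096)) * exp (m / 2 ^ 14)"
      using q by (intro mult_right_mono) auto
    thus ?thesis by (simp add: mult.assoc flip: exp_add)
  qed
  have q0: "q \<ge> 0" by (simp add: q_def)
  have "cmod (F z) \<le> cmod (f z) + n * q / cmod (G z)"
    unfolding F_def q_def using norm_triangle_ineq4[of "f z" "of_real n * P z / G z"]
    by (simp add: norm_mult norm_divide n_def del: of_nat_Suc)
  also have "cmod (f z) \<le> 2 * (q * exp (m / 2 ^ 14))"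
  proof -
    have "cmod (f z) \<le> 2 * q * exp (4 * a * Re S)" unfolding q_def by (rule norm_f_le[OF z])
    also have "\<dots> \<le> 2 * q * exp (m / 2 ^ 14)" using aS q0 by (intro mult_left_mono) auto
    finally show ?thesis by simp
  qed
  also have "n * q / cmod (G z) \<le> 128 * (q * exp (m / 2 ^ 14))"
  proof -
    have "cmod (G z) \<ge> m / 64"
      using G_ge[of "1 / 16"] B by (simp add: z_def)
    hence "n * q / cmod (G z) \<le> 2 * m * q / (m / 64)"
      using m_pos q0 by (intro frac_le mult_right_mono) (auto simp: n_def)
    also have "\<dots> = 128 * (q * 1)" using m_pos by simp
    also have "\<dots> \<le> 128 * (q * exp (m / 2 ^ 14))" using q0 by (intro mult_left_mono) auto
    finally show ?thesis .
  qed
  finally have Fz: "cmod (F z) \<le> 130 * (q * exp (m / 2 ^ 14))" by simp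
  \<comment> \<open>At the end of the ray \<open>F\<close> must still have modulus at least
    \<open>n p / (2 B)\<close>, whereas the bounds on \<open>f\<close> and \<open>P\<close> there
    are exponentially small in \<open>m\<close> relative to \<open>p\<close>.\<close>
  have "n * p / B \<le> n * p / (2 * B) + cmod (F z)"
    using diff norm_triangle_sub[of "F (\<gamma> 0)" "F z"] F0
    by (simp add: z_def norm_minus_commute)
  hence "n * p / (2 * B) \<le> 130 * (q * exp (m / 2 ^ 14))"
    using Fz by (simp add: field_simps)
  also have "\<dots> \<le> 130 * (p * exp (- (3 * m / 2 ^ 14)))" using qexp by simp
  finally have main: "n * p / (2 * B) \<le> 130 * (p * exp (- (3 * m / 2 ^ 14)))" .
  have "B * p \<le> n * p" using norm_S_le p by (intro mult_right_mono) (auto simp: B_def n_def)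
  hence "p / 2 \<le> n * p / (2 * B)" using B by (simp add: field_simps)
  hence "p * (1 / 2) \<le> p * (130 * exp (- (3 * m / 2 ^ 14)))" using main by simp
  hence "1 / 2 \<le> 130 * exp (- (3 * m / 2 ^ 14))" using p by simp
  hence "exp (3 * m / 2 ^ 14) \<le> 260" by (simp add: exp_minus field_simps)
  hence "1 + 3 * m / 2 ^ 14 \<le> 260" using exp_ge_add_one_self[of "3 * m / 2 ^ 14"] by linarith
  thus ?thesis by simp
qed

lemma degree_bound: "real m \<le> 2000000 + 4 * exp 4096"
proof (cases "cmod S ^ 2 \<le> 512 * m")
  case True
  thus ?thesis using degree_bound_degenerate by simp
next
  case False
  moreover have "exp (4096 :: real) \<ge> 0" by simp
  ultimately show ?thesis using degree_bound_descent by linarith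
qed

end

section \<open>From the degree bound to polynomials and sequences\<close>

theorem critical_point_near_zero:
  fixes p :: "complex poly" and a :: real
  assumes monic: "lead_coeff p = 1" and roots: "\<And>z. poly p z = 0 \<Longrightarrow> cmod z \<le> 1"
    and a: "0 \<le> a" "a \<le> 1 / 2 ^ 16" "poly p (of_real a) = 0"
    and deg: "real (degree p) > 2000001 + 4 * exp 4096"
  obtains z where "z \<in> cball (of_real a) 1" "poly (pderiv p) z = 0"
proof (rule ccontr)
  assume "\<not> thesis"
  hence nocrit: "cmod (z - of_real a) > 1" if "poly (pderiv p) z = 0" for z
    using that \<open>\<And>z. z \<in> cball (of_real a) 1 \<Longrightarrow> poly (pderiv p) z = 0 \<Longrightarrow> thesis\<close>
    by (force simp: dist_norm norm_minus_commute)
  define m where "m = degree p - 1"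
  have exp0: "exp (4096 :: real) \<ge> 0" by simp
  have deg_gt: "degree p > 1" using deg exp0 by linarith
  have Suc_m: "Suc m = degree p" using deg_gt by (simp add: m_def)
  \<comment> \<open>Normalising the derivative to be monic lets its zeros be listed with
    multiplicity.\<close>
  define q where "q = smult (1 / of_nat (degree p)) (pderiv p)"
  have deg_q: "degree q = m" using deg_gt by (simp add: q_def m_def degree_pderiv)
  have "lead_coeff (pderiv p) = of_nat (degree p)"
    using monic deg_gt by (simp add: degree_pderiv coeff_pderiv)
  hence monic_q: "lead_coeff q = 1" using deg_gt by (simp add: q_def)
  obtain r where r: "\<And>z. poly q z = (\<Prod>j<degree q. z - r j)"
      "\<And>j. j < degree q \<Longrightarrow> poly q (r j) = 0"
    using monic_poly_splits[OF monic_q] by blast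
  have crit: "poly (pderiv p) z = degree p * (\<Prod>j<m. z - r j)" for z
    using r(1)[of z] deg_gt unfolding deg_q by (simp add: q_def field_simps)
  have root: "poly (pderiv p) (r j) = 0" if "j < m" for j
    using r(2)[of j] deg_gt that unfolding deg_q by (simp add: q_def)
  have r1: "cmod (r j) \<le> 1" if "j < m" for j
    using critical_points_in_disc[OF monic roots _ root[OF that]] deg_gt by simp
  interpret critical_free_disc m r a "poly p"
  proof
    show "(poly p has_field_derivative of_nat (Suc m) * (\<Prod>j<m. z - r j)) (at z)" for z
      using poly_DERIV[of p z] by (simp only: Suc_m crit)
    show "cmod (poly p z) \<le> 2 * cmod (\<Prod>j<m. 1 - cnj (r j) * z)" if "cmod z \<le> 1" for z
      using norm_le_reflected_critical_product[OF monic roots _ crit r1 that] deg_gt by simp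
  qed (use a deg_gt m_def r1 nocrit root in auto)
  \<comment> \<open>The degree is \<open>m + 1\<close>, which accounts for 2000001 in place of
    2000000.\<close>
  show False using degree_bound deg Suc_m by linarith
qed

theorem theorem3p1:
  fixes N :: "nat \<Rightarrow> nat"
    and f :: "nat \<Rightarrow> complex poly"
    and a :: "nat \<Rightarrow> real"
  assumes N_to_infinity: "filterlim N at_top sequentially"
    and degree_f: "\<And>n. n \<in> range N \<Longrightarrow> degree (f n) = n"
    and monic_f: "\<And>n. n \<in> range N \<Longrightarrow> lead_coeff (f n) = 1"
    and zeroes_f: "\<And>n z. n \<in> range N \<Longrightarrow> poly (f n) z = 0 \<Longrightarrow> z \<in> cball 0 1"
    and a_range: "\<And>n. n \<in> range N \<Longrightarrow> a n \<in> {0..1}"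
    and f_a: "\<And>n. n \<in> range N \<Longrightarrow> poly (f n) (complex_of_real (a n)) = 0"
    and a_small: "(\<lambda>k. a (N k) * ln (real (N k))) \<longlonglongrightarrow> 0"
  shows "\<not> (\<forall>n \<in> range N. \<forall>z \<in> cball (complex_of_real (a n)) 1. poly (pderiv (f n)) z \<noteq> 0)"
proof -
  have "eventually (\<lambda>k. a (N k) * ln (real (N k)) < 1 / 2 ^ 16) sequentially"
    using a_small by (rule order_tendstoD) simp
  moreover have "eventually (\<lambda>k. N k \<ge> nat \<lceil>2000002 + 4 * exp (4096 :: real)\<rceil>) sequentially"
    using N_to_infinity unfolding filterlim_at_top by blast
  ultimately have "eventually (\<lambda>k. a (N k) * ln (real (N k)) < 1 / 2 ^ 16 \<and>
      N k \<ge> nat \<lceil>2000002 + 4 * exp (4096 :: real)\<rceil>) sequentially"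
    by (rule eventually_conj)
  then obtain k where k: "a (N k) * ln (real (N k)) < 1 / 2 ^ 16"
      "N k \<ge> nat \<lceil>2000002 + 4 * exp (4096 :: real)\<rceil>"
    by (auto simp: eventually_sequentially)
  define n where "n = N k"
  have n: "n \<in> range N" by (simp add: n_def)
  have large: "real n \<ge> 2000002 + 4 * exp 4096" using k(2) unfolding n_def by linarith
  \<comment> \<open>Once \<open>ln n \<ge> 1\<close>, the smallness of \<open>a n * ln n\<close>
    passes to \<open>a n\<close> itself.\<close>
  have "exp 1 \<le> real n" using large exp_ge_add_one_self[of 4096] exp_le by linarith
  hence "ln (real n) \<ge> 1" using large ln_ge_iff[of "real n" 1] exp_gt_zero[of "1::real"] by linarith
  hence "a n * 1 \<le> a n * ln (real n)" using a_range[OF n] by (intro mult_left_mono) auto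
  hence small: "a n \<le> 1 / 2 ^ 16" using k(1) by (simp add: n_def)
  obtain z where "z \<in> cball (complex_of_real (a n)) 1" "poly (pderiv (f n)) z = 0"
  proof (rule critical_point_near_zero[OF monic_f[OF n] _ _ small f_a[OF n]])
    show "cmod z \<le> 1" if "poly (f n) z = 0" for z
      using zeroes_f[OF n that] by simp
    show "0 \<le> a n" using a_range[OF n] by simp
    show "2000001 + 4 * exp 4096 < real (degree (f n))"
      using large degree_f[OF n] by simp
  qed
  thus ?thesis using n by blast
qed

end
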